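(* Let $n\ge1$ and let $a_1,\dots,a_n$ be nonzero octonions. The map $\varphi:\mathbb{O}\to\mathbb{O}$, $\varphi(x)=a_1(a_2(\cdots(a_nxa_n^{-1})\cdots)a_2^{-1})a_1^{-1}$, is an automorphism of the octonion algebra if and only if $$b_n=a_n^2(a_{n-1}^2(\cdots(a_2^2a_1^3a_2)\cdots)a_{n-1})a_n\in\mathbb{R}.$$
   Context: $\mathbb{O}$ denotes the real algebra of octonions (8-dimensional alternative normed division algebra); an automorphism is an $\mathbb{R}$-linear bijection $\varphi$ with $\varphi(xy)=\varphi(x)\varphi(y)$ for all $x,y$. For $n=1$, $b_1=a_1^3$. *)

theory Defs
  imports "HOL-Analysis.Analysis"
begin

text \<open>
  The octonions, in coordinates with respect to a basis \<open>1 = e0, e1, ..., e7\<close> with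
  \<open>ei * ei = - 1\<close> for \<open>1 \<le> i\<close> and, indices \<open>1, ..., 7\<close> being read modulo 7,
  \<open>ei * e(i+1) = e(i+3) = - e(i+1) * ei\<close> together with the cyclic permutations of this relation.
  The multiplication is not associative, so the type is not an instance of \<open>ring\<close>. The lemmas
  below show that it is a unital real alternative division algebra with a multiplicative
  Euclidean norm.
\<close>

datatype octo = Octo
  (oct0: real)
  (oct1: real)
  (oct2: real)
  (oct3: real)
  (oct4: real)
  (oct5: real)
  (oct6: real)
  (oct7: real)

lemma octo_eq_iff:
  "x = y \<longleftrightarrow> oct0 x = oct0 y \<and> oct1 x = oct1 y \<and> oct2 x = oct2 y \<and> oct3 x = oct3 y
     \<and> oct4 x = oct4 y \<and> oct5 x = oct5 y \<and> oct6 x = oct6 y \<and> oct7 x = oct7 y"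
  by (cases x; cases y) simp

instantiation octo :: real_vector
begin

definition zero_octo :: octo where
  "0 = Octo 0 0 0 0 0 0 0 0"

definition plus_octo :: "octo \<Rightarrow> octo \<Rightarrow> octo" where
  "x + y = Octo
     (oct0 x + oct0 y) (oct1 x + oct1 y) (oct2 x + oct2 y) (oct3 x + oct3 y)
     (oct4 x + oct4 y) (oct5 x + oct5 y) (oct6 x + oct6 y) (oct7 x + oct7 y)"

definition uminus_octo :: "octo \<Rightarrow> octo" where
  "- x = Octo
     (- oct0 x) (- oct1 x) (- oct2 x) (- oct3 x)
     (- oct4 x) (- oct5 x) (- oct6 x) (- oct7 x)"

definition minus_octo :: "octo \<Rightarrow> octo \<Rightarrow> octo" where
  "x - y = Octo
     (oct0 x - oct0 y) (oct1 x - oct1 y) (oct2 x - oct2 y) (oct3 x - oct3 y)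
     (oct4 x - oct4 y) (oct5 x - oct5 y) (oct6 x - oct6 y) (oct7 x - oct7 y)"

definition scaleR_octo :: "real \<Rightarrow> octo \<Rightarrow> octo" where
  "scaleR r x = Octo
     (r * oct0 x) (r * oct1 x) (r * oct2 x) (r * oct3 x)
     (r * oct4 x) (r * oct5 x) (r * oct6 x) (r * oct7 x)"

instance
  by standard
    (simp_all add: octo_eq_iff zero_octo_def plus_octo_def uminus_octo_def minus_octo_def
      scaleR_octo_def algebra_simps)

end

instantiation octo :: real_normed_vector
begin

definition norm_octo :: "octo \<Rightarrow> real" where
  "norm x = sqrt
    ((oct0 x)\<^sup>2 + (oct1 x)\<^sup>2 + (oct2 x)\<^sup>2 + (oct3 x)\<^sup>2
     + (oct4 x)\<^sup>2 + (oct5 x)\<^sup>2 + (oct6 x)\<^sup>2 + (oct7 x)\<^sup>2)"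

definition sgn_octo :: "octo \<Rightarrow> octo" where
  "sgn x = inverse (norm x) *\<^sub>R x" for x :: octo

definition dist_octo :: "octo \<Rightarrow> octo \<Rightarrow> real" where
  "dist x y = norm (x - y)" for x y :: octo

definition uniformity_octo :: "(octo \<times> octo) filter" where
  "uniformity = (INF e\<in>{0<..}. principal {(x :: octo, y). dist x y < e})"

definition open_octo :: "octo set \<Rightarrow> bool" where
  "open U \<longleftrightarrow> (\<forall>x\<in>U. eventually (\<lambda>(x', y). x' = x \<longrightarrow> y \<in> U) uniformity)" for U :: "octo set"

instance
proof
  fix x y :: octo and r :: real
  let ?t = "\<lambda>x. (oct0 x, oct1 x, oct2 x, oct3 x, oct4 x, oct5 x, oct6 x, oct7 x)"
  have norm_eq: "norm x = norm (?t x)" for x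
    by (simp add: norm_octo_def norm_Pair add.assoc)
  show "norm x = 0 \<longleftrightarrow> x = 0"
    by (simp add: norm_eq octo_eq_iff zero_octo_def zero_prod_def)
  have "?t (x + y) = ?t x + ?t y"
    by (simp add: plus_octo_def)
  then show "norm (x + y) \<le> norm x + norm y"
    unfolding norm_eq by (simp only: norm_triangle_ineq)
  have "?t (r *\<^sub>R x) = r *\<^sub>R ?t x"
    by (simp add: scaleR_octo_def)
  then show "norm (r *\<^sub>R x) = \<bar>r\<bar> * norm x"
    unfolding norm_eq by (simp only: norm_scaleR)
qed (simp_all add: sgn_octo_def dist_octo_def uniformity_octo_def open_octo_def)

end

instantiation octo :: "{one, times, inverse}"
begin

definition one_octo :: octo where
  "1 = Octo 1 0 0 0 0 0 0 0"

definition times_octo :: "octo \<Rightarrow> octo \<Rightarrow> octo" where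
  "x * y = Octo
     (oct0 x * oct0 y - oct1 x * oct1 y - oct2 x * oct2 y - oct3 x * oct3 y
      - oct4 x * oct4 y - oct5 x * oct5 y - oct6 x * oct6 y - oct7 x * oct7 y)
     (oct0 x * oct1 y + oct1 x * oct0 y + oct2 x * oct4 y + oct3 x * oct7 y
      - oct4 x * oct2 y + oct5 x * oct6 y - oct6 x * oct5 y - oct7 x * oct3 y)
     (oct0 x * oct2 y - oct1 x * oct4 y + oct2 x * oct0 y + oct3 x * oct5 y
      + oct4 x * oct1 y - oct5 x * oct3 y + oct6 x * oct7 y - oct7 x * oct6 y)
     (oct0 x * oct3 y - oct1 x * oct7 y - oct2 x * oct5 y + oct3 x * oct0 y
      + oct4 x * oct6 y + oct5 x * oct2 y - oct6 x * oct4 y + oct7 x * oct1 y)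
     (oct0 x * oct4 y + oct1 x * oct2 y - oct2 x * oct1 y - oct3 x * oct6 y
      + oct4 x * oct0 y + oct5 x * oct7 y + oct6 x * oct3 y - oct7 x * oct5 y)
     (oct0 x * oct5 y - oct1 x * oct6 y + oct2 x * oct3 y - oct3 x * oct2 y
      - oct4 x * oct7 y + oct5 x * oct0 y + oct6 x * oct1 y + oct7 x * oct4 y)
     (oct0 x * oct6 y + oct1 x * oct5 y - oct2 x * oct7 y + oct3 x * oct4 y
      - oct4 x * oct3 y - oct5 x * oct1 y + oct6 x * oct0 y + oct7 x * oct2 y)
     (oct0 x * oct7 y + oct1 x * oct3 y + oct2 x * oct6 y - oct3 x * oct1 y
      + oct4 x * oct5 y - oct5 x * oct4 y - oct6 x * oct2 y + oct7 x * oct0 y)"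

text \<open>The conjugate of \<open>x\<close> divided by the square of its norm; in particular \<open>inverse 0 = 0\<close>.\<close>

definition inverse_octo :: "octo \<Rightarrow> octo" where
  "inverse x = (1 / (norm x)\<^sup>2) *\<^sub>R Octo (oct0 x) (- oct1 x) (- oct2 x) (- oct3 x)
     (- oct4 x) (- oct5 x) (- oct6 x) (- oct7 x)"

definition divide_octo :: "octo \<Rightarrow> octo \<Rightarrow> octo" where
  "x div y = x * inverse y" for x y :: octo

instance ..

end

text \<open>With this instance \<open>x ^ Suc k = x * x ^ k\<close>.\<close>

instance octo :: power ..

lemmas octo_defs = octo_eq_iff zero_octo_def one_octo_def plus_octo_def uminus_octo_def
  minus_octo_def scaleR_octo_def times_octo_def

lemma octo_mult_1: "1 * x = x" "x * 1 = x" for x :: octo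
  by (simp_all add: octo_defs)

lemma octo_distrib: "(x + y) * z = x * z + y * z" "x * (y + z) = x * y + x * z" for x y z :: octo
  by (simp_all add: octo_defs algebra_simps)

lemma octo_mult_scaleR: "(r *\<^sub>R x) * y = r *\<^sub>R (x * y)" "x * (r *\<^sub>R y) = r *\<^sub>R (x * y)" for x y :: octo
  by (simp_all add: octo_defs algebra_simps)

lemma octo_alternative: "(x * x) * y = x * (x * y)" "(y * x) * x = y * (x * x)" for x y :: octo
  by (simp_all add: octo_defs algebra_simps)

lemma octo_flexible: "(x * y) * x = x * (y * x)" for x y :: octo
  by (simp add: octo_defs algebra_simps)

lemma octo_norm_mult: "norm (x * y) = norm x * norm y" for x y :: octo
  unfolding norm_octo_def real_sqrt_mult [symmetric]
  by (rule arg_cong [where f = sqrt]) (simp add: times_octo_def power2_eq_square algebra_simps)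

lemma octo_inverse: "x * inverse x = 1" "inverse x * x = 1" if "x \<noteq> 0" for x :: octo
proof -
  let ?c = "Octo (oct0 x) (- oct1 x) (- oct2 x) (- oct3 x)
    (- oct4 x) (- oct5 x) (- oct6 x) (- oct7 x)"
  have "x * ?c = (norm x)\<^sup>2 *\<^sub>R 1" "?c * x = (norm x)\<^sup>2 *\<^sub>R 1"
    by (simp_all add: norm_octo_def octo_defs power2_eq_square algebra_simps)
  with that show "x * inverse x = 1" "inverse x * x = 1"
    by (simp_all add: inverse_octo_def octo_mult_scaleR)
qed

lemma octo_power2: "x\<^sup>2 = x * x" for x :: octo
  by (simp add: power_def numeral_2_eq_2 octo_mult_1)

lemma octo_power3: "x ^ 3 = x * (x * x)" for x :: octo
  by (simp add: power_def numeral_3_eq_3 octo_mult_1)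

text \<open>The library constant \<open>\<real>\<close> needs an associative algebra.\<close>

definition octo_Reals :: "octo set" where
  "octo_Reals = range (\<lambda>r. r *\<^sub>R 1)"

definition octo_automorphism :: "(octo \<Rightarrow> octo) \<Rightarrow> bool" where
  "octo_automorphism \<phi> \<longleftrightarrow> linear \<phi> \<and> bij \<phi> \<and> (\<forall>x y. \<phi> (x * y) = \<phi> x * \<phi> y)"

text \<open>
  \<open>conj_comp a n x = a 1 (a 2 ( ... (a n x (a n)\<^sup>-\<^sup>1) ... ) (a 2)\<^sup>-\<^sup>1) (a 1)\<^sup>-\<^sup>1\<close>: the conjugation by
  \<open>a n\<close> is applied first. The products \<open>a x a\<^sup>-\<^sup>1\<close> and \<open>a\<^sup>2 b a\<close> below need no parentheses, because
  any two octonions generate an associative subalgebra (which contains their inverses).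
\<close>

fun conj_comp :: "(nat \<Rightarrow> octo) \<Rightarrow> nat \<Rightarrow> octo \<Rightarrow> octo" where
  "conj_comp a 0 x = x"
| "conj_comp a (Suc n) x = conj_comp a n (a (Suc n) * x * inverse (a (Suc n)))"

text \<open>
  \<open>companion a n = (a n)\<^sup>2 ( ... ((a 2)\<^sup>2 (a 1)\<^sup>3 (a 2)) ... ) (a n)\<close> for \<open>n \<ge> 1\<close>, where
  \<open>a 1\<close> is innermost; the value at \<open>n = 0\<close> is a convention.
\<close>

fun companion :: "(nat \<Rightarrow> octo) \<Rightarrow> nat \<Rightarrow> octo" where
  "companion a 0 = 1"
| "companion a (Suc 0) = a 1 ^ 3"
| "companion a (Suc (Suc n)) = (a (Suc (Suc n)))\<^sup>2 * companion a (Suc n) * a (Suc (Suc n))"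

end

theory Submission
  imports Defs
begin

text \<open>
  Write \<open>C x = a x a\<^sup>-\<^sup>1\<close>. The Moufang identities give \<open>(a\<^sup>2 b a) w = a\<^sup>2 (b (C w)) a\<close>, so
  the companion \<open>b\<close> of \<open>\<phi> = conj_comp a n\<close> satisfies, by induction on \<open>n\<close>, \<open>(b x) y = b z\<close>
  whenever \<open>\<phi> z = \<phi> x \<phi> y\<close>. In other words the inverse of \<open>\<phi>\<close> is a pseudo-automorphism
  with left companion \<open>b\<close>. Hence \<open>\<phi>\<close> is multiplicative iff \<open>(b x) y = b (x y)\<close> for all \<open>x\<close>, \<open>y\<close>,
  that is, iff \<open>b\<close> lies in the nucleus of the octonions, which is \<open>\<real>\<close>.
\<close>

lemma octo_alternative_polarized:
  fixes x y z :: octo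
  shows "(x * y) * z + (y * x) * z = x * (y * z) + y * (x * z)" (is ?left)
    and "(x * y) * z + (x * z) * y = x * (y * z) + x * (z * y)" (is ?right)
proof -
  show ?left
    using octo_alternative(1) [of "x + y" z] octo_alternative(1) [of x z] octo_alternative(1) [of y z]
    by (simp add: octo_distrib add.commute)
  show ?right
    using octo_alternative(2) [of x "y + z"] octo_alternative(2) [of x y] octo_alternative(2) [of x z]
    by (simp add: octo_distrib add.commute)
qed

text \<open>The associator \<open>(x * y) * z - x * (y * z)\<close> is alternating, hence invariant
  under cyclic shifts.\<close>

lemma octo_associator_cyclic: "(x * y) * z + y * (z * x) = (y * z) * x + x * (y * z)"
  for x y z :: octo
  using octo_alternative_polarized(1) [of x y z] octo_alternative_polarized(2) [of y x z]
  by (simp add: octo_eq_iff plus_octo_def)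

text \<open>
  By the polarized alternative law \<open>x \<mapsto> (\<lambda>y. x y)\<close> respects the Jordan product
  \<open>x \<circ> y = x y + y x\<close>, hence also \<open>a \<circ> (a \<circ> x) - a\<^sup>2 \<circ> x = 2 a x a\<close>.
\<close>

lemma octo_moufang_left: "(a * (x * a)) * y = a * (x * (a * y))" for a x y :: octo
proof -
  note P = octo_alternative_polarized(1)
  have "(a * (a * x)) * y + (a * (x * a)) * y + ((a * (x * a)) * y + ((x * a) * a) * y) =
      a * ((a * x) * y) + a * ((x * a) * y) + ((a * x) * (a * y) + (x * a) * (a * y))"
    using P [of a "a * x + x * a" y] by (simp add: octo_distrib octo_flexible)
  moreover have "(a * (a * x)) * y + ((x * a) * a) * y = a * (a * (x * y)) + x * (a * (a * y))"
    using P [of "a * a" x y] by (simp add: octo_alternative)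
  moreover have "a * ((a * x) * y) + a * ((x * a) * y) = a * (a * (x * y)) + a * (x * (a * y))"
    using P [of a x y] by (simp flip: octo_distrib)
  moreover have "(a * x) * (a * y) + (x * a) * (a * y) = a * (x * (a * y)) + x * (a * (a * y))"
    by (rule P)
  ultimately show ?thesis
    by (simp add: octo_eq_iff plus_octo_def)
qed

lemma octo_moufang_middle: "(a * x) * (y * a) = a * ((x * y) * a)" for a x y :: octo
proof -
  have "(a * x) * (y * a) + (a * (y * a)) * x = a * (x * (y * a)) + a * ((y * a) * x)"
    by (rule octo_alternative_polarized)
  moreover have "(a * (y * a)) * x = a * (y * (a * x))"
    by (rule octo_moufang_left)
  moreover have "a * ((x * y) * a) + a * (y * (a * x)) = a * ((y * a) * x) + a * (x * (y * a))"
    using octo_associator_cyclic [of x y a] by (simp flip: octo_distrib)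
  ultimately show ?thesis
    by (simp add: octo_eq_iff plus_octo_def)
qed

text \<open>\<open>a\<^sup>-\<^sup>1\<close> lies in the span of \<open>1\<close> and \<open>a\<close>, so alternativity lets it cancel.\<close>

lemma octo_inverse_span: "\<exists>s t. inverse a = s *\<^sub>R 1 + t *\<^sub>R a" for a :: octo
  \<comment> \<open>The conjugate of \<open>a\<close> is twice its real part minus
    \<open>a\<close>.\<close>
  by (intro exI [of _ "2 * oct0 a / (norm a)\<^sup>2"] exI [of _ "- 1 / (norm a)\<^sup>2"])
    (simp add: inverse_octo_def octo_defs field_simps)

lemma octo_inverse_cancel:
  fixes a x :: octo
  assumes "a \<noteq> 0"
  shows "inverse a * (a * x) = x" "a * (inverse a * x) = x"
    "(x * a) * inverse a = x" "(x * inverse a) * a = x"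
proof -
  obtain s t where inv: "inverse a = s *\<^sub>R 1 + t *\<^sub>R a"
    using octo_inverse_span by blast
  have "inverse a * (a * x) = (inverse a * a) * x" "a * (inverse a * x) = (a * inverse a) * x"
    "(x * a) * inverse a = x * (a * inverse a)" "(x * inverse a) * a = x * (inverse a * a)"
    by (simp_all add: inv octo_distrib octo_mult_scaleR octo_mult_1 octo_alternative)
  with assms show "inverse a * (a * x) = x" "a * (inverse a * x) = x"
    "(x * a) * inverse a = x" "(x * inverse a) * a = x"
    by (simp_all add: octo_inverse octo_mult_1)
qed

lemma octo_power2_mult: "a\<^sup>2 * x = a * (a * x)" for a x :: octo
  by (simp add: octo_power2 octo_alternative)

text \<open>The value 1 at index 0 makes the recursion uniform, so inductions can start
  there.\<close>

lemma companion_Suc: "companion a (Suc n) = (a (Suc n))\<^sup>2 * companion a n * a (Suc n)"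
  by (cases n) (simp_all add: octo_power2 octo_power3 octo_mult_1 octo_alternative)

lemma companion_step_mult:
  fixes a b w :: octo
  assumes "a \<noteq> 0"
  shows "((a\<^sup>2 * b) * a) * w = (a\<^sup>2 * (b * (a * w * inverse a))) * a"
proof -
  define c where "c = a * w * inverse a"
  \<comment> \<open>Replacing \<open>a * w\<close> by \<open>c * a\<close> gives the shape of the
    middle Moufang identity.\<close>
  have c: "c * a = a * w"
    by (simp add: c_def octo_inverse_cancel assms)
  have "((a\<^sup>2 * b) * a) * w = a * ((a * b) * (a * w))"
    by (simp add: octo_power2_mult octo_flexible flip: octo_moufang_left)
  also have "\<dots> = a * (a * ((b * c) * a))"
    by (simp add: c [symmetric] octo_moufang_middle)
  also have "\<dots> = (a\<^sup>2 * (b * c)) * a"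
    by (simp add: octo_power2_mult octo_flexible)
  finally show ?thesis
    by (simp add: c_def)
qed

lemma companion_pseudo_automorphism:
  assumes "\<And>i. i \<in> {1..n} \<Longrightarrow> a i \<noteq> 0"
    and "conj_comp a n z = conj_comp a n x * conj_comp a n y"
  shows "(companion a n * x) * y = companion a n * z"
  using assms
proof (induction n arbitrary: x y z)
  case 0
  then show ?case
    by (simp add: octo_mult_1)
next
  case (Suc n)
  let ?C = "\<lambda>w. a (Suc n) * w * inverse (a (Suc n))"
  have "a (Suc n) \<noteq> 0"
    using Suc.prems(1) by simp
  moreover have "(companion a n * ?C x) * ?C y = companion a n * ?C z"
    using Suc.prems by (intro Suc.IH) auto
  \<comment> \<open>The factors \<open>x\<close> and \<open>y\<close> are absorbed one after the
    other, becoming \<open>?C x\<close> and \<open>?C y\<close> inside; the same law read backwards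
    extracts \<open>z\<close>.\<close>
  ultimately show ?case
    by (simp add: companion_Suc companion_step_mult)
qed

lemma linear_conj_comp: "linear (conj_comp a n)"
proof (induction n)
  case 0
  show ?case
    by (simp add: linear_iff)
next
  case (Suc n)
  then show ?case
    by (simp add: linear_iff octo_distrib octo_mult_scaleR)
qed

lemma bij_conj_comp:
  assumes "\<And>i. i \<in> {1..n} \<Longrightarrow> a i \<noteq> 0"
  shows "bij (conj_comp a n)"
  using assms
proof (induction n)
  case 0
  have "conj_comp a 0 = id"
    by (simp add: fun_eq_iff)
  then show ?case
    by (simp only: bij_id)
next
  case (Suc n)
  let ?a = "a (Suc n)"
  have "?a \<noteq> 0"
    using Suc.prems by simp
  then have "bij (\<lambda>x. ?a * x * inverse ?a)"
    by (intro o_bij [where g = "\<lambda>x. inverse ?a * (x * ?a)"])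
      (simp_all add: fun_eq_iff octo_inverse_cancel)
  moreover have "bij (conj_comp a n)"
    using Suc by simp
  moreover have "conj_comp a (Suc n) = conj_comp a n \<circ> (\<lambda>x. ?a * x * inverse ?a)"
    by (simp add: fun_eq_iff)
  ultimately show ?case
    by (metis bij_comp)
qed

lemma companion_nonzero:
  assumes "\<And>i. i \<in> {1..n} \<Longrightarrow> a i \<noteq> 0"
  shows "companion a n \<noteq> 0"
  using assms
proof (induction n)
  case 0
  show ?case
    by (simp add: octo_defs)
next
  case (Suc n)
  then have "norm (companion a n) \<noteq> 0" "norm (a (Suc n)) \<noteq> 0"
    by simp_all
  then have "norm (companion a (Suc n)) \<noteq> 0"
    by (simp add: companion_Suc octo_power2 octo_norm_mult del: norm_eq_zero)
  then show ?case
    by simp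
qed

lemma octo_nucleus:
  fixes b :: octo
  assumes "\<And>x y. (b * x) * y = b * (x * y)"
  shows "b \<in> octo_Reals"
proof -
  let ?e1 = "Octo 0 1 0 0 0 0 0 0" and ?e2 = "Octo 0 0 1 0 0 0 0 0"
    and ?e3 = "Octo 0 0 0 1 0 0 0 0" and ?e5 = "Octo 0 0 0 0 0 1 0 0"
  have "b = oct0 b *\<^sub>R 1"
    \<comment> \<open>Each pair confines \<open>b\<close> to the quaternion subalgebra it generates.
      The imaginary units in these are e1, e2, e4; e2, e3, e5; e1, e3, e7, and no unit is common to
      all three.\<close>
    using assms [of ?e1 ?e2] assms [of ?e3 ?e5] assms [of ?e1 ?e3]
    by (simp add: octo_defs)
  then show ?thesis
    unfolding octo_Reals_def by (rule range_eqI)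
qed

theorem theorem2:
  fixes n :: nat and a :: "nat \<Rightarrow> octo"
  assumes "n \<ge> 1"
    and "\<And>i. i \<in> {1..n} \<Longrightarrow> a i \<noteq> 0"
  shows "octo_automorphism (conj_comp a n) \<longleftrightarrow> companion a n \<in> octo_Reals"
proof
  assume "octo_automorphism (conj_comp a n)"
  then have "(companion a n * x) * y = companion a n * (x * y)" for x y
    using assms(2) by (intro companion_pseudo_automorphism) (auto simp: octo_automorphism_def)
  then show "companion a n \<in> octo_Reals"
    by (rule octo_nucleus)
next
  assume "companion a n \<in> octo_Reals"
  then obtain r where r: "companion a n = r *\<^sub>R 1"
    by (auto simp: octo_Reals_def)
  have "r \<noteq> 0"
    using companion_nonzero [of n a] assms(2) r by auto
  have bij: "bij (conj_comp a n)"
    using assms(2) by (rule bij_conj_comp)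
  have "conj_comp a n (x * y) = conj_comp a n x * conj_comp a n y" for x y
  proof -
    \<comment> \<open>Surjectivity supplies \<open>z\<close>; cancelling the real companion
      \<open>r\<close> then identifies it with \<open>x * y\<close>.\<close>
    obtain z where z: "conj_comp a n z = conj_comp a n x * conj_comp a n y"
      using bij by (metis bij_pointE)
    have "(companion a n * x) * y = companion a n * z"
      using assms(2) z by (rule companion_pseudo_automorphism)
    then have "x * y = z"
      using \<open>r \<noteq> 0\<close> by (simp add: r octo_mult_scaleR octo_mult_1)
    with z show ?thesis
      by simp
  qed
  with bij linear_conj_comp show "octo_automorphism (conj_comp a n)"
    by (simp add: octo_automorphism_def)
qed

end
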